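(* Let $\mathbb{V}$ be a protomodular variety of universal algebras, with $n$, $\theta$, $\alpha_1,\dots,\alpha_n$, $e_1,\dots,e_n$ as in the context, and let $A$ be a right-cancellable $\mathbb{V}$-algebra. Then any topology on $A$ which makes $A$ a topological algebra and satisfies the separation axiom $T_0$ is completely regular.
   Context: Let $\mathbb{V}$ be a variety of universal algebras of a type $\mathcal{F}$. $\mathbb{V}$ is protomodular if and only if its algebraic theory contains, for some natural number $n$, constants $e_1,\dots,e_n$, binary operations $\alpha_1,\dots,\alpha_n$ and an $(n+1)$-ary operation $\theta$ (all given by terms in the operations of $\mathcal{F}$) such that the identities $\alpha_i(a,a)=e_i$ ($1\le i\le n$) and $\theta(\alpha_1(a,b),\alpha_2(a,b),\dots,\alpha_n(a,b),b)=a$ hold in $\mathbb{V}$. Such $n,\theta,\alpha_i,e_i$ are fixed. A $\mathbb{V}$-algebra $A$ is called right-cancellable if for all $a_1,\dots,a_n,a'_1,\dots,a'_n,b,b'\in A$ and all $1\le i\le n$, $$\alpha_i(\theta(a_1,\dots,a_n,b),\theta(a'_1,\dots,a'_n,b))=\alpha_i(\theta(a_1,\dots,a_n,b'),\theta(a'_1,\dots,a'_n,b')).$$ A topological algebra is an algebra equipped with a topology such that all operations from $\mathcal{F}$ are continuous (hence so are all term operations, in particular $\theta$ and the $\alpha_i$). "Completely regular" means $T_{3\frac12}$: $T_1$, and for every closed set $F$ and every point $x\notin F$ there is a continuous function to $[0,1]$ which is $0$ at $x$ and $1$ on $F$. *)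

theory Defs
  imports "HOL-Analysis.Analysis"
begin

section \<open>Terms and algebras of a finitary type\<close>

text \<open>
  A type of algebras is a set \<open>F\<close> of operation symbols with arities \<open>ar\<close>. An algebra of that
  type is a carrier \<open>A\<close> with an interpretation \<open>I\<close>; only the values of \<open>I f xs\<close> with \<open>f \<in> F\<close>,
  \<open>length xs = ar f\<close> and entries of \<open>xs\<close> in \<open>A\<close> are relevant.
\<close>

datatype 'f trm = Var nat | Op 'f "'f trm list"

fun wf_trm :: "'f set \<Rightarrow> ('f \<Rightarrow> nat) \<Rightarrow> 'f trm \<Rightarrow> bool" where
  "wf_trm F ar (Var x) \<longleftrightarrow> True"
| "wf_trm F ar (Op f ts) \<longleftrightarrow> f \<in> F \<and> length ts = ar f \<and> (\<forall>t\<in>set ts. wf_trm F ar t)"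

fun tvars :: "'f trm \<Rightarrow> nat set" where
  "tvars (Var x) = {x}"
| "tvars (Op f ts) = (\<Union>t\<in>set ts. tvars t)"

fun tsubst :: "(nat \<Rightarrow> 'f trm) \<Rightarrow> 'f trm \<Rightarrow> 'f trm" where
  "tsubst \<sigma> (Var x) = \<sigma> x"
| "tsubst \<sigma> (Op f ts) = Op f (map (tsubst \<sigma>) ts)"

fun teval :: "('f \<Rightarrow> 'a list \<Rightarrow> 'a) \<Rightarrow> (nat \<Rightarrow> 'a) \<Rightarrow> 'f trm \<Rightarrow> 'a" where
  "teval I \<rho> (Var x) = \<rho> x"
| "teval I \<rho> (Op f ts) = I f (map (teval I \<rho>) ts)"

text \<open>A term of arity \<open>k\<close> has its variables among \<open>Var 0, \<dots>, Var (k - 1)\<close>.\<close>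

definition term_of_arity :: "'f set \<Rightarrow> ('f \<Rightarrow> nat) \<Rightarrow> nat \<Rightarrow> 'f trm \<Rightarrow> bool" where
  "term_of_arity F ar k t \<longleftrightarrow> wf_trm F ar t \<and> tvars t \<subseteq> {..<k}"

definition term_op :: "('f \<Rightarrow> 'a list \<Rightarrow> 'a) \<Rightarrow> 'f trm \<Rightarrow> 'a list \<Rightarrow> 'a" where
  "term_op I t xs = teval I (\<lambda>i. xs ! i) t"

definition is_algebra ::
    "'f set \<Rightarrow> ('f \<Rightarrow> nat) \<Rightarrow> 'a set \<Rightarrow> ('f \<Rightarrow> 'a list \<Rightarrow> 'a) \<Rightarrow> bool" where
  "is_algebra F ar A I \<longleftrightarrow>
     (\<forall>f\<in>F. \<forall>xs. length xs = ar f \<and> set xs \<subseteq> A \<longrightarrow> I f xs \<in> A)"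

definition satisfies ::
    "'a set \<Rightarrow> ('f \<Rightarrow> 'a list \<Rightarrow> 'a) \<Rightarrow> 'f trm \<Rightarrow> 'f trm \<Rightarrow> bool" where
  "satisfies A I s t \<longleftrightarrow> (\<forall>\<rho>. (\<forall>x. \<rho> x \<in> A) \<longrightarrow> teval I \<rho> s = teval I \<rho> t)"

section \<open>Varieties\<close>

text \<open>A variety is given by its type \<open>(F, ar)\<close> and a set \<open>E\<close> of defining identities.\<close>

definition identities :: "'f set \<Rightarrow> ('f \<Rightarrow> nat) \<Rightarrow> ('f trm \<times> 'f trm) set \<Rightarrow> bool" where
  "identities F ar E \<longleftrightarrow> (\<forall>(s, t)\<in>E. wf_trm F ar s \<and> wf_trm F ar t)"

definition in_variety ::
    "'f set \<Rightarrow> ('f \<Rightarrow> nat) \<Rightarrow> ('f trm \<times> 'f trm) set \<Rightarrow> 'a set \<Rightarrow> ('f \<Rightarrow> 'a list \<Rightarrow> 'a) \<Rightarrow> bool"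
  where
  "in_variety F ar E A I \<longleftrightarrow> is_algebra F ar A I \<and> (\<forall>(s, t)\<in>E. satisfies A I s t)"

text \<open>
  An identity holds in the variety if it holds in all its algebras. A definition cannot quantify
  over all carrier types; it suffices to consider carriers inside the type of terms, because a
  valuation only reaches a subalgebra generated by countably many elements, and this is a
  quotient of the term algebra. Lemma \<open>variety_satisfiesD\<close> below confirms that the identity then
  holds in every algebra of the variety, over any type.
\<close>

definition variety_satisfies ::
    "'f set \<Rightarrow> ('f \<Rightarrow> nat) \<Rightarrow> ('f trm \<times> 'f trm) set \<Rightarrow> 'f trm \<Rightarrow> 'f trm \<Rightarrow> bool" where
  "variety_satisfies F ar E s t \<longleftrightarrow>
     (\<forall>(C :: 'f trm set) J. in_variety F ar E C J \<longrightarrow> satisfies C J s t)"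

lemma teval_in_carrier:
  assumes "is_algebra F ar A I" "\<And>x. \<rho> x \<in> A" "wf_trm F ar t"
  shows "teval I \<rho> t \<in> A"
  using assms(3)
proof (induction t)
  case (Op f ts)
  then have "set (map (teval I \<rho>) ts) \<subseteq> A" by auto
  then show ?case using Op.prems assms(1) by (auto simp: is_algebra_def)
qed (simp add: assms(2))

lemma variety_satisfiesD:
  fixes A :: "'a set"
  assumes E: "identities F ar E" and wf: "wf_trm F ar s" "wf_trm F ar t"
    and st: "variety_satisfies F ar E s t" and V: "in_variety F ar E A I"
  shows "satisfies A I s t"
  unfolding satisfies_def
proof (intro allI impI)
  fix \<rho> :: "nat \<Rightarrow> 'a" assume \<rho>: "\<forall>x. \<rho> x \<in> A"
  have alg: "is_algebra F ar A I" using V by (simp add: in_variety_def)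
  define G where "G = {u. wf_trm F ar u}"
  define h where "h = teval I \<rho>"
  define r where "r y = (SOME u. u \<in> G \<and> h u = y)" for y
  define C where "C = r ` h ` G"
  define J where "J f us = r (h (Op f us))" for f us
  have r: "r y \<in> G \<and> h (r y) = y" if "y \<in> h ` G" for y
    unfolding r_def by (rule someI_ex) (use that in auto)
  have CG: "C \<subseteq> G" using r by (auto simp: C_def)
  have rh: "r (h u) = u" if "u \<in> C" for u using that r by (auto simp: C_def)
  have hA: "h u \<in> A" if "u \<in> G" for u
    using that teval_in_carrier[OF alg] \<rho> by (auto simp: h_def G_def)
  have OpG: "Op f us \<in> G" if "f \<in> F" "length us = ar f" "set us \<subseteq> C" for f us
    using that CG by (auto simp: G_def)
  have algC: "is_algebra F ar C J"
    unfolding is_algebra_def using OpG by (auto simp: J_def C_def)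
  have ev: "h (teval J \<sigma> u) = teval I (\<lambda>x. h (\<sigma> x)) u"
    if \<sigma>: "\<forall>x. \<sigma> x \<in> C" and "wf_trm F ar u" for \<sigma> u
    using that(2)
  proof (induction u)
    case (Op f us)
    have "set (map (teval J \<sigma>) us) \<subseteq> C"
      using Op.prems teval_in_carrier[OF algC] \<sigma> by auto
    then have "Op f (map (teval J \<sigma>) us) \<in> G" using Op.prems by (intro OpG) auto
    then have "h (teval J \<sigma> (Op f us)) = h (Op f (map (teval J \<sigma>) us))"
      using r by (simp add: J_def)
    also have "\<dots> = I f (map (\<lambda>v. h (teval J \<sigma> v)) us)" by (simp add: h_def o_def)
    also have "map (\<lambda>v. h (teval J \<sigma> v)) us = map (teval I (\<lambda>x. h (\<sigma> x))) us"
      using Op by simp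
    finally show ?case by simp
  qed simp
  have sat: "teval J \<sigma> u = teval J \<sigma> v"
    if \<sigma>: "\<forall>x. \<sigma> x \<in> C" and uv: "(u, v) \<in> E" for \<sigma> u v
  proof -
    have w: "wf_trm F ar u" "wf_trm F ar v" using E uv by (auto simp: identities_def)
    have "satisfies A I u v" using V uv by (auto simp: in_variety_def)
    moreover have "\<forall>x. h (\<sigma> x) \<in> A" using \<sigma> CG hA by blast
    ultimately have "h (teval J \<sigma> u) = h (teval J \<sigma> v)"
      by (simp add: ev \<sigma> w satisfies_def)
    moreover have "teval J \<sigma> u \<in> C" "teval J \<sigma> v \<in> C"
      using teval_in_carrier[OF algC] \<sigma> w by auto
    ultimately show ?thesis using rh by metis
  qed
  have "in_variety F ar E C J" using algC sat by (auto simp: in_variety_def satisfies_def)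
  then have sC: "satisfies C J s t" using st by (simp add: variety_satisfies_def)
  define \<sigma> where "\<sigma> x = r (h (Var x))" for x
  have VarG: "Var x \<in> G" for x by (simp add: G_def)
  have \<sigma>: "\<forall>x. \<sigma> x \<in> C" using VarG by (auto simp: \<sigma>_def C_def)
  have h\<sigma>: "(\<lambda>x. h (\<sigma> x)) = \<rho>"
  proof
    fix x
    have "h (\<sigma> x) = h (Var x)" using r[OF imageI[OF VarG[of x]]] by (simp add: \<sigma>_def)
    then show "h (\<sigma> x) = \<rho> x" by (simp add: h_def)
  qed
  have "teval J \<sigma> s = teval J \<sigma> t" using sC \<sigma> by (simp add: satisfies_def)
  then show "teval I \<rho> s = teval I \<rho> t" using ev[OF \<sigma>] wf h\<sigma> by metis
qed

section \<open>Protomodular varieties and right-cancellable algebras\<close>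

text \<open>
  Indices are shifted to \<open>0, \<dots>, n - 1\<close>. In \<open>\<theta>\<close>, \<open>Var i\<close> with \<open>i < n\<close> stands for the argument
  of index \<open>i\<close> and \<open>Var n\<close> for the last argument. The two identities are
  \<open>\<alpha> i (Var 0, Var 0) = e i\<close> and
  \<open>\<theta> (\<alpha> 0 (Var 0, Var 1), \<dots>, \<alpha> (n - 1) (Var 0, Var 1), Var 1) = Var 0\<close>.
\<close>

definition protomodular_variety ::
    "'f set \<Rightarrow> ('f \<Rightarrow> nat) \<Rightarrow> ('f trm \<times> 'f trm) set \<Rightarrow>
     nat \<Rightarrow> 'f trm \<Rightarrow> (nat \<Rightarrow> 'f trm) \<Rightarrow> (nat \<Rightarrow> 'f trm) \<Rightarrow> bool" where
  "protomodular_variety F ar E n \<theta> \<alpha> e \<longleftrightarrow>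
     identities F ar E \<and>
     term_of_arity F ar (Suc n) \<theta> \<and>
     (\<forall>i<n. term_of_arity F ar 2 (\<alpha> i) \<and> term_of_arity F ar 0 (e i)) \<and>
     (\<forall>i<n. variety_satisfies F ar E (tsubst (\<lambda>_. Var 0) (\<alpha> i)) (e i)) \<and>
     variety_satisfies F ar E (tsubst (\<lambda>j. if j < n then \<alpha> j else Var 1) \<theta>) (Var 0)"

definition right_cancellable ::
    "nat \<Rightarrow> 'f trm \<Rightarrow> (nat \<Rightarrow> 'f trm) \<Rightarrow> 'a set \<Rightarrow> ('f \<Rightarrow> 'a list \<Rightarrow> 'a) \<Rightarrow> bool" where
  "right_cancellable n \<theta> \<alpha> A I \<longleftrightarrow>
     (\<forall>as as' b b'. length as = n \<and> length as' = n \<and> set as \<subseteq> A \<and> set as' \<subseteq> A \<and>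
        b \<in> A \<and> b' \<in> A \<longrightarrow>
        (\<forall>i<n. term_op I (\<alpha> i) [term_op I \<theta> (as @ [b]), term_op I \<theta> (as' @ [b])] =
                term_op I (\<alpha> i) [term_op I \<theta> (as @ [b']), term_op I \<theta> (as' @ [b'])]))"

section \<open>Topological algebras\<close>

definition topological_algebra ::
    "'f set \<Rightarrow> ('f \<Rightarrow> nat) \<Rightarrow> 'a set \<Rightarrow> ('f \<Rightarrow> 'a list \<Rightarrow> 'a) \<Rightarrow> 'a topology \<Rightarrow> bool" where
  "topological_algebra F ar A I T \<longleftrightarrow>
     is_algebra F ar A I \<and> topspace T = A \<and>
     (\<forall>f\<in>F. continuous_map (product_topology (\<lambda>_. T) {..<ar f}) T
        (\<lambda>x. I f (map x [0..<ar f])))"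

end

theory Submission
  imports Defs
begin

text \<open>
  Write \<open>\<alpha> x y\<close> for the tuple of the \<open>\<alpha> i x y\<close> and let \<open>e = \<alpha> x x\<close>. The tuple \<open>\<alpha> x y\<close> plays the role
  of the quotient \<open>x y\<inverse>\<close> in a topological group: the relations \<open>D V = {(x, y). \<alpha> x y \<in> V}\<close>, with
  \<open>V\<close> an open neighbourhood of \<open>e\<close> in the power \<open>A\<^sup>n\<close>, serve as entourages that induce the topology.
  They are neighbourhoods of the diagonal because \<open>\<alpha>\<close> is continuous, and they separate points from
  closed sets because \<open>x = \<theta> (\<alpha> x y) y\<close> tends to \<open>\<theta> e y = y\<close> as \<open>\<alpha> x y\<close> tends to \<open>e\<close>.
  Right-cancellability gives the triangle axiom: it lets one translate \<open>x, y, z\<close> so that \<open>z\<close> becomes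
  a fixed point \<open>b\<close>, whence \<open>\<alpha> x z = \<alpha> (\<theta> (\<alpha> x y) (\<theta> (\<alpha> y z) b)) b\<close> is a continuous function of
  \<open>\<alpha> x y\<close> and \<open>\<alpha> y z\<close> alone, with value \<open>e\<close> at \<open>(e, e)\<close> (lemma
  \<open>completely_regular_space_protomodular\<close>).

  A topology induced by such entourages is completely regular (lemma
  \<open>completely_regular_space_entourages\<close>): Urysohn's construction applies to sets related by
  "the image of \<open>S\<close> under some \<open>D V\<close> is contained in \<open>S'\<close>", a relation that is dense by the triangle
  axiom. Finally a completely regular space is regular, and a regular \<open>T\<^sub>0\<close> space is Hausdorff, hence
  \<open>T\<^sub>1\<close>.
\<close>

section \<open>Urysohn functions and entourages\<close>

lemma dyadics_dense_unit_interval: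
  fixes a b :: real
  assumes "0 \<le> a" "a < b" "b \<le> 1"
  obtains r where "r \<in> dyadics \<inter> {0..1}" "a < r" "r < b"
proof -
  have "closure ({a<..<b} \<inter> (\<Union>k m. {real m / 2 ^ k})) = closure {a<..<b}"
    using assms by (intro closure_dyadic_rationals_in_convex_set_pos_1) auto
  moreover have "closure {a<..<b} \<noteq> {}"
    using assms by simp
  ultimately have "{a<..<b} \<inter> dyadics \<noteq> {}"
    by (metis closure_empty dyadics_def)
  then show thesis
    using that assms by fastforce
qed

text \<open>
  Urysohn's construction with the interpolation property made explicit. In a normal space the relation
  \<open>R\<close> would hold between open sets when the closure of the first lies in the second; here it may be
  stronger, and between sets that are neither open nor closed.
\<close>

lemma Urysohn_function_dense_relation:
  assumes top: "\<And>U V. R U V \<Longrightarrow> U \<subseteq> topspace X \<and> V \<subseteq> topspace X"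
    and strong: "\<And>U V. R U V \<Longrightarrow> X closure_of U \<subseteq> X interior_of V"
    and dense: "\<And>U V. R U V \<Longrightarrow> \<exists>W. R U W \<and> R W V"
    and trans: "\<And>U V W. R U V \<Longrightarrow> R V W \<Longrightarrow> R U W"
    and ST: "R S T"
  shows "\<exists>f. continuous_map X euclideanreal f \<and> f ` S \<subseteq> {0} \<and> f ` (- T) \<subseteq> {1}"
proof -
  let ?D = "dyadics \<inter> {0..1::real}"
  have "\<exists>G :: real \<Rightarrow> 'a set. G 0 = S \<and> G 1 = T \<and> (\<forall>r \<in> ?D. \<forall>s \<in> ?D. r < s \<longrightarrow> R (G r) (G s))"
    by (rule recursion_on_dyadic_fractions[of R, OF ST]) (blast intro: dense trans)+
  then obtain G :: "real \<Rightarrow> 'a set" where G0: "G 0 = S" and G1: "G 1 = T"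
    and G: "\<And>r s. r \<in> ?D \<Longrightarrow> s \<in> ?D \<Longrightarrow> r < s \<Longrightarrow> R (G r) (G s)"
    by blast
  have 01: "0 \<in> ?D" "1 \<in> ?D"
    using real_in_dyadics[of 0] real_in_dyadics[of 1] by auto
  have clG: "X closure_of (G r) \<subseteq> X interior_of (G s)"
    if "r \<in> ?D" "s \<in> ?D" "r < s" for r s
    using G strong that by blast
  have Gtop: "G r \<subseteq> topspace X" if "r \<in> ?D" for r
    using top[OF G[OF 01(1) that]] top[OF G[OF 01(1,2)]] G0 that by (cases "r = 0") auto
  have mono: "G r \<subseteq> G s" if "r \<in> ?D" "s \<in> ?D" "r \<le> s" for r s
  proof (cases "r = s")
    case False
    then have "R (G r) (G s)" using G that by simp
    then show ?thesis
      using Gtop[OF that(1)] strong by (meson closure_of_subset interior_of_subset subset_trans)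
  qed simp
  define f where "f x = Inf (insert 1 {r \<in> ?D. x \<in> G r})" for x
  have f_le: "f x \<le> r" if "r \<in> ?D" "x \<in> G r" for x r
    unfolding f_def by (rule cInf_lower) (use that in \<open>auto intro: bdd_belowI[of _ 0]\<close>)
  have f_le1: "f x \<le> 1" for x
    unfolding f_def by (rule cInf_lower) (auto intro: bdd_belowI[of _ 0])
  have f_ge: "a \<le> f x" if "a \<le> 1" "\<And>r. r \<in> ?D \<Longrightarrow> x \<in> G r \<Longrightarrow> a \<le> r" for x a
    unfolding f_def by (rule cInf_greatest) (use that in auto)
  have f_ge0: "0 \<le> f x" for x
    by (rule f_ge) auto
  have f_outside: "r \<le> f x" if "r \<in> ?D" "x \<notin> G r" for x r
    by (rule f_ge) (use that mono in \<open>auto intro: leI dest: less_imp_le\<close>)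
  have f_less: "\<exists>r \<in> ?D. r < a \<and> x \<in> G r" if "f x < a" "a \<le> 1" for x a
    using that f_ge[of a x] by (meson not_less)
  have "openin X {x \<in> topspace X. f x < a}" for a
  proof (cases "a \<le> 1")
    case True
    have "{x \<in> topspace X. f x < a} = (\<Union>r \<in> {r \<in> ?D. r < a}. X interior_of (G r))"
    proof (intro subset_antisym subsetI)
      fix x assume x: "x \<in> {x \<in> topspace X. f x < a}"
      then obtain r where r: "r \<in> ?D" "r < a" "x \<in> G r"
        using f_less True by blast
      \<comment> \<open>\<open>G r\<close> need not be open, so one passes to the interior of a slightly larger set.\<close>
      obtain s where s: "s \<in> ?D" "r < s" "s < a"
        using dyadics_dense_unit_interval[of r a] r True by auto
      have "x \<in> X interior_of (G s)"
        using clG[OF r(1) s(1,2)] r(3) closure_of_subset[OF Gtop[OF r(1)]] by blast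
      then show "x \<in> (\<Union>r \<in> {r \<in> ?D. r < a}. X interior_of (G r))"
        using s by auto
    next
      fix x assume "x \<in> (\<Union>r \<in> {r \<in> ?D. r < a}. X interior_of (G r))"
      then obtain r where r: "r \<in> ?D" "r < a" "x \<in> X interior_of (G r)" by blast
      have "x \<in> G r" "x \<in> topspace X"
        using subsetD[OF interior_of_subset r(3)] subsetD[OF interior_of_subset_topspace r(3)] .
      then show "x \<in> {x \<in> topspace X. f x < a}"
        using f_le[OF r(1)] r(2) by fastforce
    qed
    then show ?thesis by auto
  next
    case False
    then have "{x \<in> topspace X. f x < a} = topspace X"
      using le_less_trans[OF f_le1] by auto
    then show ?thesis by simp
  qed
  moreover have "openin X {x \<in> topspace X. a < f x}" for a
  proof (cases "0 \<le> a")
    case True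
    have "{x \<in> topspace X. a < f x} = (\<Union>r \<in> {r \<in> ?D. a < r}. topspace X - X closure_of (G r))"
    proof (intro subset_antisym subsetI)
      fix x assume x: "x \<in> {x \<in> topspace X. a < f x}"
      obtain s where s: "s \<in> ?D" "a < s" "s < f x"
        using dyadics_dense_unit_interval[of a "f x"] x f_le1 True by auto
      obtain r where r: "r \<in> ?D" "a < r" "r < s"
        using dyadics_dense_unit_interval[of a s] s True by auto
      have "x \<notin> G s"
        using f_le[OF s(1)] s(3) by fastforce
      then have "x \<notin> X closure_of (G r)"
        using clG[OF r(1) s(1) r(3)] interior_of_subset[of X "G s"] by blast
      then show "x \<in> (\<Union>r \<in> {r \<in> ?D. a < r}. topspace X - X closure_of (G r))"
        using x r by auto
    next
      fix x assume "x \<in> (\<Union>r \<in> {r \<in> ?D. a < r}. topspace X - X closure_of (G r))"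
      then obtain r where r: "r \<in> ?D" "a < r" "x \<in> topspace X" "x \<notin> X closure_of (G r)"
        by blast
      then have "r \<le> f x"
        using f_outside[OF r(1)] closure_of_subset[OF Gtop[OF r(1)]] by blast
      then show "x \<in> {x \<in> topspace X. a < f x}"
        using r by auto
    qed
    moreover have "openin X (\<Union>r \<in> {r \<in> ?D. a < r}. topspace X - X closure_of (G r))"
      by (rule openin_Union) (auto intro: openin_diff[OF openin_topspace closedin_closure_of])
    ultimately show ?thesis by (simp only:)
  next
    case False
    then have "{x \<in> topspace X. a < f x} = topspace X"
      using less_le_trans[OF _ f_ge0] by auto
    then show ?thesis by simp
  qed
  ultimately have "continuous_map X euclideanreal f"
    by (simp add: continuous_map_upper_lower_semicontinuous_lt)
  moreover have "f ` S \<subseteq> {0}"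
    using f_le[OF 01(1)] f_ge0 G0 by (auto intro: antisym)
  moreover have "f ` (- T) \<subseteq> {1}"
    using f_outside[OF 01(2)] f_le1 G1 by (auto intro: antisym)
  ultimately show ?thesis by blast
qed

text \<open>
  The entourages are used in one direction only: a closed set \<open>C\<close> is separated from a point \<open>x\<close> by
  enlarging \<open>C\<close>, and \<open>D `` C\<close> misses \<open>x\<close> as soon as no pair of \<open>D\<close> leads from \<open>C\<close> to \<open>x\<close>. Openness
  of \<open>D `` {x}\<close> makes these enlargements open; openness of \<open>D\<inverse> `` {x}\<close> makes them contain closures.
\<close>

lemma completely_regular_space_entourages:
  assumes carrier: "\<And>D. D \<in> \<D> \<Longrightarrow> D \<subseteq> topspace X \<times> topspace X"
    and diag: "\<And>D x. D \<in> \<D> \<Longrightarrow> x \<in> topspace X \<Longrightarrow> (x, x) \<in> D"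
    and open_right: "\<And>D x. D \<in> \<D> \<Longrightarrow> x \<in> topspace X \<Longrightarrow> openin X (D `` {x})"
    and open_left: "\<And>D x. D \<in> \<D> \<Longrightarrow> x \<in> topspace X \<Longrightarrow> openin X (D\<inverse> `` {x})"
    and triangle: "\<And>D. D \<in> \<D> \<Longrightarrow> \<exists>D' \<in> \<D>. D' O D' \<subseteq> D"
    and basis: "\<And>U x. openin X U \<Longrightarrow> x \<in> U \<Longrightarrow> \<exists>D \<in> \<D>. D\<inverse> `` {x} \<subseteq> U"
  shows "completely_regular_space X"
  unfolding completely_regular_space_alt
proof (intro allI impI)
  fix C x assume C: "closedin X C" and x: "x \<in> topspace X - C"
  define R where "R U V \<longleftrightarrow> U \<subseteq> topspace X \<and> V \<subseteq> topspace X \<and> (\<exists>D \<in> \<D>. D `` U \<subseteq> V)" for U V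
  have extensive: "U \<subseteq> D `` U" if "D \<in> \<D>" "U \<subseteq> topspace X" for D U
    using diag that by blast
  have closure_image: "X closure_of U \<subseteq> D `` U" if "D \<in> \<D>" "U \<subseteq> topspace X" for D U
  proof
    fix z assume z: "z \<in> X closure_of U"
    then have ztop: "z \<in> topspace X" by (simp add: in_closure_of)
    have "\<exists>y. y \<in> U \<and> y \<in> D\<inverse> `` {z}"
    proof -
      have "z \<in> D\<inverse> `` {z}" using diag[OF that(1) ztop] by simp
      then show ?thesis
        using z open_left[OF that(1) ztop] unfolding in_closure_of by meson
    qed
    then show "z \<in> D `` U" by blast
  qed
  have open_image: "openin X (D `` U)" if "D \<in> \<D>" "U \<subseteq> topspace X" for D U
  proof -
    have "D `` U = (\<Union>x \<in> U. D `` {x})" by blast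
    then show ?thesis using open_right that by (auto intro!: openin_Union)
  qed
  have top: "U \<subseteq> topspace X \<and> V \<subseteq> topspace X" if "R U V" for U V
    using that by (simp add: R_def)
  have strong: "X closure_of U \<subseteq> X interior_of V" if "R U V" for U V
  proof -
    obtain D where "D \<in> \<D>" "D `` U \<subseteq> V" "U \<subseteq> topspace X"
      using \<open>R U V\<close> by (auto simp: R_def)
    then show ?thesis
      using closure_image[of D U] interior_of_maximal[OF _ open_image[of D U], of V] by simp
  qed
  have dense: "\<exists>W. R U W \<and> R W V" if "R U V" for U V
  proof -
    obtain D where D: "D \<in> \<D>" "D `` U \<subseteq> V" and UV: "U \<subseteq> topspace X" "V \<subseteq> topspace X"
      using \<open>R U V\<close> by (auto simp: R_def)
    obtain D' where D': "D' \<in> \<D>" "D' O D' \<subseteq> D"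
      using triangle D(1) by blast
    have "D' `` (D' `` U) \<subseteq> V"
      using D' D(2) by blast
    moreover have "D' `` U \<subseteq> topspace X"
      using carrier D'(1) by blast
    ultimately have "R U (D' `` U)" "R (D' `` U) V"
      using D'(1) UV by (auto simp: R_def)
    then show ?thesis by blast
  qed
  have trans: "R U W" if "R U V" "R V W" for U V W
  proof -
    obtain D where D: "D \<in> \<D>" "D `` U \<subseteq> V"
      using \<open>R U V\<close> by (auto simp: R_def)
    have "V \<subseteq> X closure_of V"
      using top[OF \<open>R V W\<close>] by (simp add: closure_of_subset)
    then have "D `` U \<subseteq> W"
      using D(2) strong[OF \<open>R V W\<close>] interior_of_subset[of X W] by simp
    then show ?thesis
      using D(1) that by (auto simp: R_def)
  qed
  have RC: "R C (topspace X - {x})"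
  proof -
    obtain D where D: "D \<in> \<D>" "D\<inverse> `` {x} \<subseteq> topspace X - C"
      using basis[of "topspace X - C" x] C x by blast
    then have "D `` C \<subseteq> topspace X - {x}"
      using carrier[OF D(1)] by blast
    then show ?thesis
      using D(1) closedin_subset[OF C] by (auto simp: R_def)
  qed
  have "\<exists>f. continuous_map X euclideanreal f \<and> f ` C \<subseteq> {0} \<and> f ` (- (topspace X - {x})) \<subseteq> {1}"
    by (rule Urysohn_function_dense_relation[of R]) (fact top strong dense trans RC)+
  then obtain f where f: "continuous_map X euclideanreal f" "f ` C \<subseteq> {0}" "f x = 1"
    by blast
  have "continuous_map X euclideanreal (\<lambda>y. 1 - f y)"
    using f(1) by (intro continuous_intros)
  then show "\<exists>g. continuous_map X euclideanreal g \<and> g x = 0 \<and> g ` C \<subseteq> {1}"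
    using f by (intro exI[of _ "\<lambda>y. 1 - f y"]) auto
qed

section \<open>The uniformity of a right-cancellable protomodular structure\<close>

text \<open>
  The space \<open>P\<close> stands for the power \<open>A\<^sup>n\<close>; the argument handles the tuples of values of the \<open>\<alpha> i\<close>, which
  are the arguments of \<open>\<theta>\<close>, as single points of it.
\<close>

lemma completely_regular_space_protomodular:
  fixes X :: "'a topology" and P :: "'p topology"
  assumes cont_\<alpha>: "continuous_map (prod_topology X X) P (\<lambda>(x, y). \<alpha> x y)"
    and cont_\<theta>: "continuous_map (prod_topology P X) X (\<lambda>(u, y). \<theta> u y)"
    and \<alpha>_diag: "\<And>x. x \<in> topspace X \<Longrightarrow> \<alpha> x x = e"
    and \<theta>_\<alpha>: "\<And>x y. x \<in> topspace X \<Longrightarrow> y \<in> topspace X \<Longrightarrow> \<theta> (\<alpha> x y) y = x"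
    and cancel: "\<And>u v b b'. u \<in> topspace P \<Longrightarrow> v \<in> topspace P \<Longrightarrow> b \<in> topspace X \<Longrightarrow>
        b' \<in> topspace X \<Longrightarrow> \<alpha> (\<theta> u b) (\<theta> v b) = \<alpha> (\<theta> u b') (\<theta> v b')"
  shows "completely_regular_space X"
proof (cases "topspace X = {}")
  case True
  then show ?thesis by (simp add: completely_regular_space_def)
next
  case False
  then obtain b where b: "b \<in> topspace X" by blast
  have \<alpha>_in: "\<alpha> x y \<in> topspace P" if "x \<in> topspace X" "y \<in> topspace X" for x y
    using continuous_map_image_subset_topspace[OF cont_\<alpha>] that by auto
  have \<theta>_in: "\<theta> u y \<in> topspace X" if "u \<in> topspace P" "y \<in> topspace X" for u y
    using continuous_map_image_subset_topspace[OF cont_\<theta>] that by auto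
  have e_in: "e \<in> topspace P"
    using \<alpha>_in[OF b b] \<alpha>_diag[OF b] by simp
  have \<theta>_e: "\<theta> e y = y" if "y \<in> topspace X" for y
    using \<theta>_\<alpha>[OF that that] \<alpha>_diag[OF that] by simp
  have cont_\<alpha>': "continuous_map Y P (\<lambda>t. \<alpha> (f t) (g t))"
    if "continuous_map Y X f" "continuous_map Y X g" for Y :: "'t topology" and f g
    using continuous_map_compose[OF continuous_map_pairedI[OF that] cont_\<alpha>] by (simp add: o_def)
  have cont_\<theta>': "continuous_map Y X (\<lambda>t. \<theta> (f t) (g t))"
    if "continuous_map Y P f" "continuous_map Y X g" for Y :: "'t topology" and f g
    using continuous_map_compose[OF continuous_map_pairedI[OF that] cont_\<theta>] by (simp add: o_def)
  \<comment> \<open>The counterpart of the product: in a group with \<open>\<alpha> x y = x y\<inverse>\<close> and \<open>\<theta> u y = u y\<close> it is \<open>u v\<close>.\<close>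
  define m where "m u v = \<alpha> (\<theta> u (\<theta> v b)) b" for u v
  have \<alpha>_m: "\<alpha> x z = m (\<alpha> x y) (\<alpha> y z)"
    if xyz: "x \<in> topspace X" "y \<in> topspace X" "z \<in> topspace X" for x y z
  proof -
    \<comment> \<open>\<open>\<theta> (\<alpha> w z) b\<close> is the translate of \<open>w\<close> under which \<open>z\<close> becomes \<open>b\<close>.\<close>
    define \<tau> where "\<tau> w = \<theta> (\<alpha> w z) b" for w
    have \<tau>_in: "\<tau> w \<in> topspace X" if "w \<in> topspace X" for w
      using \<theta>_in \<alpha>_in b xyz that by (simp add: \<tau>_def)
    have \<tau>: "\<alpha> (\<tau> v) (\<tau> w) = \<alpha> v w" if "v \<in> topspace X" "w \<in> topspace X" for v w
      using cancel[of "\<alpha> v z" "\<alpha> w z" b z] \<theta>_\<alpha> \<alpha>_in b xyz that by (simp add: \<tau>_def)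
    have \<tau>z: "\<tau> z = b"
      using \<alpha>_diag \<theta>_e b xyz by (simp add: \<tau>_def)
    have "\<theta> (\<alpha> x y) (\<tau> y) = \<tau> x"
      using \<tau>[of x y] \<theta>_\<alpha>[of "\<tau> x" "\<tau> y"] \<tau>_in xyz by simp
    then have "m (\<alpha> x y) (\<alpha> y z) = \<alpha> (\<tau> x) b"
      by (simp add: m_def \<tau>_def)
    then show ?thesis
      using \<tau>[of x z] \<tau>z xyz by simp
  qed
  define D where "D V = {(x, y) \<in> topspace X \<times> topspace X. \<alpha> x y \<in> V}" for V
  show ?thesis
  proof (rule completely_regular_space_entourages[where \<D> = "D ` {V. openin P V \<and> e \<in> V}"])
    fix E x assume "E \<in> D ` {V. openin P V \<and> e \<in> V}" and x: "x \<in> topspace X"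
    then obtain V where V: "openin P V" "e \<in> V" and E: "E = D V" by blast
    show "(x, x) \<in> E"
      using x V \<alpha>_diag by (simp add: E D_def)
    have "E `` {x} = {y \<in> topspace X. \<alpha> x y \<in> V}"
      using x by (auto simp: E D_def)
    moreover have "continuous_map X P (\<lambda>y. \<alpha> x y)"
      using x by (intro cont_\<alpha>' continuous_map_id[unfolded id_def]) auto
    ultimately show "openin X (E `` {x})"
      using V(1) by (simp add: openin_continuous_map_preimage)
    have "E\<inverse> `` {x} = {y \<in> topspace X. \<alpha> y x \<in> V}"
      using x by (auto simp: E D_def)
    moreover have "continuous_map X P (\<lambda>y. \<alpha> y x)"
      using x by (intro cont_\<alpha>' continuous_map_id[unfolded id_def]) auto
    ultimately show "openin X (E\<inverse> `` {x})"
      using V(1) by (simp add: openin_continuous_map_preimage)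
  next
    fix E assume "E \<in> D ` {V. openin P V \<and> e \<in> V}"
    then obtain V where V: "openin P V" "e \<in> V" and E: "E = D V" by blast
    show "E \<subseteq> topspace X \<times> topspace X"
      by (auto simp: E D_def)
    have "continuous_map (prod_topology P P) P (\<lambda>t. m (fst t) (snd t))"
      unfolding m_def using b
      by (intro cont_\<alpha>' cont_\<theta>' continuous_map_fst continuous_map_snd) auto
    then have "openin (prod_topology P P) {t \<in> topspace (prod_topology P P). m (fst t) (snd t) \<in> V}"
      (is "openin _ ?Q")
      using V(1) by (rule openin_continuous_map_preimage)
    moreover have "m e e = e"
      using \<theta>_e \<alpha>_diag b by (simp add: m_def)
    then have "(e, e) \<in> ?Q"
      using e_in V(2) by simp
    ultimately obtain V1 V2 where V12: "openin P V1" "openin P V2" "e \<in> V1" "e \<in> V2" "V1 \<times> V2 \<subseteq> ?Q"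
      unfolding openin_prod_topology_alt by meson
    have "D (V1 \<inter> V2) O D (V1 \<inter> V2) \<subseteq> E"
    proof clarify
      fix x y z assume "(x, y) \<in> D (V1 \<inter> V2)" "(y, z) \<in> D (V1 \<inter> V2)"
      then have xyz: "x \<in> topspace X" "y \<in> topspace X" "z \<in> topspace X"
        and "(\<alpha> x y, \<alpha> y z) \<in> V1 \<times> V2"
        by (auto simp: D_def)
      with V12(5) have "m (\<alpha> x y) (\<alpha> y z) \<in> V" by auto
      then show "(x, z) \<in> E"
        using xyz \<alpha>_m[OF xyz] by (simp add: E D_def)
    qed
    then show "\<exists>E' \<in> D ` {V. openin P V \<and> e \<in> V}. E' O E' \<subseteq> E"
      using V12 by (intro bexI[of _ "D (V1 \<inter> V2)"]) auto
  next
    fix U x assume U: "openin X U" "x \<in> U"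
    then have x: "x \<in> topspace X" using openin_subset by blast
    define V where "V = {u \<in> topspace P. \<theta> u x \<in> U}"
    have "continuous_map P X (\<lambda>u. \<theta> u x)"
      using x by (intro cont_\<theta>' continuous_map_id[unfolded id_def]) auto
    then have "openin P V"
      unfolding V_def using U(1) by (rule openin_continuous_map_preimage)
    moreover have "e \<in> V"
      using e_in \<theta>_e x U(2) by (simp add: V_def)
    moreover have "(D V)\<inverse> `` {x} \<subseteq> U"
      using \<theta>_\<alpha> by (auto simp: D_def V_def)
    ultimately show "\<exists>E \<in> D ` {V. openin P V \<and> e \<in> V}. E\<inverse> `` {x} \<subseteq> U"
      by blast
  qed
qed

section \<open>Term operations\<close>

lemma teval_tsubst: "teval I \<rho> (tsubst \<sigma> t) = teval I (\<lambda>x. teval I \<rho> (\<sigma> x)) t"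
proof (induction t)
  case (Op f ts)
  then show ?case by (simp add: o_def cong: map_cong)
qed simp

lemma teval_cong_tvars: "(\<And>i. i \<in> tvars t \<Longrightarrow> \<rho> i = \<rho>' i) \<Longrightarrow> teval I \<rho> t = teval I \<rho>' t"
proof (induction t)
  case (Op f ts)
  then have "map (teval I \<rho>) ts = map (teval I \<rho>') ts" by auto
  then show ?case by (simp only: teval.simps)
qed simp

lemma wf_trm_tsubst:
  assumes "wf_trm F ar t" "\<And>i. i \<in> tvars t \<Longrightarrow> wf_trm F ar (\<sigma> i)"
  shows "wf_trm F ar (tsubst \<sigma> t)"
  using assms by (induction t) auto

text \<open>
  The parameter space \<open>Y\<close> is arbitrary so that the operations can be seen as functions of pairs and of
  pairs of a tuple and a point, without regrouping arguments into a single finite power.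
\<close>

lemma continuous_map_teval:
  assumes "topological_algebra F ar A I T" "wf_trm F ar t"
    and "\<And>i. i \<in> tvars t \<Longrightarrow> continuous_map Y T (\<lambda>y. \<rho> y i)"
  shows "continuous_map Y T (\<lambda>y. teval I (\<rho> y) t)"
  using assms(2,3)
proof (induction t)
  case (Op f ts)
  have f: "f \<in> F" and len: "length ts = ar f" and wf: "\<And>t. t \<in> set ts \<Longrightarrow> wf_trm F ar t"
    using Op.prems(1) by auto
  define g where "g y = (\<lambda>i \<in> {..<ar f}. teval I (\<rho> y) (ts ! i))" for y
  have "continuous_map Y T (\<lambda>y. teval I (\<rho> y) (ts ! i))" if "i < ar f" for i
  proof -
    have i: "ts ! i \<in> set ts" using that len by simp
    then show ?thesis
      using Op.IH[OF i wf[OF i]] Op.prems(2) by fastforce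
  qed
  then have "continuous_map Y (product_topology (\<lambda>_. T) {..<ar f}) g"
    by (auto simp: continuous_map_componentwise g_def)
  then have "continuous_map Y T ((\<lambda>x. I f (map x [0..<ar f])) \<circ> g)"
    by (rule continuous_map_compose) (use assms(1) f in \<open>auto simp: topological_algebra_def\<close>)
  moreover have "map (g y) [0..<ar f] = map (teval I (\<rho> y)) ts" for y
    by (rule nth_equalityI) (auto simp: g_def len)
  ultimately show ?case by (simp add: o_def)
qed simp

section \<open>Right-cancellable topological algebras\<close>

theorem theorem4p2:
  fixes F :: "'f set" and ar :: "'f \<Rightarrow> nat" and E :: "('f trm \<times> 'f trm) set"
    and n :: nat and \<theta> :: "'f trm" and \<alpha> e :: "nat \<Rightarrow> 'f trm"
    and A :: "'a set" and I :: "'f \<Rightarrow> 'a list \<Rightarrow> 'a" and T :: "'a topology"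
  assumes "protomodular_variety F ar E n \<theta> \<alpha> e"
    and "in_variety F ar E A I"
    and "right_cancellable n \<theta> \<alpha> A I"
    and "topological_algebra F ar A I T"
    and "t0_space T"
  shows "t1_space T \<and> completely_regular_space T"
proof -
  have top: "topspace T = A"
    using assms(4) by (simp add: topological_algebra_def)
  have idE: "identities F ar E"
    and wf\<theta>: "wf_trm F ar \<theta>" and var\<theta>: "tvars \<theta> \<subseteq> {..<Suc n}"
    and wf\<alpha>: "\<And>i. i < n \<Longrightarrow> wf_trm F ar (\<alpha> i)" and var\<alpha>: "\<And>i. i < n \<Longrightarrow> tvars (\<alpha> i) \<subseteq> {..<2}"
    and wfe: "\<And>i. i < n \<Longrightarrow> wf_trm F ar (e i)" and vare: "\<And>i. i < n \<Longrightarrow> tvars (e i) = {}"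
    and diag: "\<And>i. i < n \<Longrightarrow> variety_satisfies F ar E (tsubst (\<lambda>_. Var 0) (\<alpha> i)) (e i)"
    and recover: "variety_satisfies F ar E (tsubst (\<lambda>j. if j < n then \<alpha> j else Var 1) \<theta>) (Var 0)"
    using assms(1) by (auto simp: protomodular_variety_def term_of_arity_def)
  define P where "P = product_topology (\<lambda>_. T) {..<n}"
  define a where "a x y = (\<lambda>i \<in> {..<n}. teval I (\<lambda>j. if j = 0 then x else y) (\<alpha> i))" for x y
  define h where "h u y = teval I (\<lambda>j. if j < n then u j else y) \<theta>" for u y
  have term_a: "term_op I (\<alpha> i) [x, y] = a x y i" if "i < n" for i x y
    unfolding term_op_def using that var\<alpha>[OF that]
    by (auto simp: a_def less_2_cases_iff intro!: teval_cong_tvars dest!: subsetD)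
  have term_h: "term_op I \<theta> (map u [0..<n] @ [y]) = h u y" for u y
    unfolding term_op_def h_def using var\<theta>
    by (intro teval_cong_tvars) (auto simp: nth_append less_Suc_eq dest!: subsetD)
  have "completely_regular_space T"
  proof (rule completely_regular_space_protomodular)
    have "continuous_map (prod_topology T T) T
        (\<lambda>t. teval I (\<lambda>j. if j = 0 then fst t else snd t) (\<alpha> i))" if "i < n" for i
    proof (rule continuous_map_teval[OF assms(4) wf\<alpha>[OF that]])
      show "continuous_map (prod_topology T T) T (\<lambda>t. if j = 0 then fst t else snd t)" for j :: nat
        by (cases "j = 0") (simp_all add: continuous_map_fst continuous_map_snd)
    qed
    then show "continuous_map (prod_topology T T) P (\<lambda>(x, y). a x y)"
      by (auto simp: P_def a_def continuous_map_componentwise case_prod_unfold)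
    have "continuous_map (prod_topology P T) T (\<lambda>t. if j < n then fst t j else snd t)" for j
    proof (cases "j < n")
      case True
      then have "continuous_map P T (\<lambda>u. u j)"
        unfolding P_def by (intro continuous_map_product_projection) auto
      from continuous_map_compose[OF continuous_map_fst this] True show ?thesis
        by (simp add: o_def)
    qed (simp add: continuous_map_snd)
    then show "continuous_map (prod_topology P T) T (\<lambda>(u, y). h u y)"
      unfolding h_def case_prod_unfold by (rule continuous_map_teval[OF assms(4) wf\<theta>])
    \<comment> \<open>The terms \<open>e i\<close> are closed, so any valuation gives their value; \<open>undefined\<close> is one that
      does not depend on \<open>x\<close>.\<close>
    show "a x x = (\<lambda>i \<in> {..<n}. teval I undefined (e i))" if "x \<in> topspace T" for x
    proof -
      have "teval I (\<lambda>_. x) (\<alpha> i) = teval I undefined (e i)" if i: "i < n" for i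
      proof -
        have "satisfies A I (tsubst (\<lambda>_. Var 0) (\<alpha> i)) (e i)"
          using variety_satisfiesD[OF idE _ wfe[OF i] diag[OF i] assms(2)] wf\<alpha>[OF i]
          by (simp add: wf_trm_tsubst)
        then have "teval I (\<lambda>_. x) (\<alpha> i) = teval I (\<lambda>_. x) (e i)"
          using \<open>x \<in> topspace T\<close> top by (auto simp: satisfies_def teval_tsubst)
        also have "\<dots> = teval I undefined (e i)"
          by (rule teval_cong_tvars) (simp add: vare i)
        finally show ?thesis .
      qed
      then show ?thesis by (auto simp: a_def)
    qed
    show "h (a x y) y = x" if "x \<in> topspace T" "y \<in> topspace T" for x y
    proof -
      let ?\<rho> = "\<lambda>j. if j = 0 then x else y"
      have "satisfies A I (tsubst (\<lambda>j. if j < n then \<alpha> j else Var 1) \<theta>) (Var 0)"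
        using variety_satisfiesD[OF idE _ _ recover assms(2)] wf\<alpha> wf\<theta>
        by (simp add: wf_trm_tsubst)
      then have "teval I (\<lambda>j. teval I ?\<rho> (if j < n then \<alpha> j else Var 1)) \<theta> = x"
        using that top by (auto simp: satisfies_def teval_tsubst)
      moreover have "(\<lambda>j. teval I ?\<rho> (if j < n then \<alpha> j else Var 1)) =
          (\<lambda>j. if j < n then a x y j else y)"
        by (auto simp: a_def)
      ultimately show ?thesis by (simp add: h_def)
    qed
    show "a (h u b) (h v b) = a (h u b') (h v b')"
      if "u \<in> topspace P" "v \<in> topspace P" "b \<in> topspace T" "b' \<in> topspace T" for u v b b'
    proof -
      have args: "length (map w [0..<n]) = n" "set (map w [0..<n]) \<subseteq> A" if "w \<in> topspace P" for w
        using that top by (auto simp: P_def PiE_iff)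
      have "a (h u b) (h v b) i = a (h u b') (h v b') i" if "i < n" for i
      proof -
        have "b \<in> A" "b' \<in> A"
          using \<open>b \<in> topspace T\<close> \<open>b' \<in> topspace T\<close> top by simp_all
        with args[OF \<open>u \<in> topspace P\<close>] args[OF \<open>v \<in> topspace P\<close>] that
        have "term_op I (\<alpha> i) [term_op I \<theta> (map u [0..<n] @ [b]), term_op I \<theta> (map v [0..<n] @ [b])] =
            term_op I (\<alpha> i) [term_op I \<theta> (map u [0..<n] @ [b']), term_op I \<theta> (map v [0..<n] @ [b'])]"
          using assms(3) unfolding right_cancellable_def by blast
        then show ?thesis
          by (simp only: term_a[OF that] term_h)
      qed
      then show ?thesis
        by (auto simp: a_def fun_eq_iff)
    qed
  qed
  moreover from this have "Hausdorff_space T"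
    using assms(5) completely_regular_imp_regular_space regular_t0_imp_Hausdorff_space by blast
  ultimately show ?thesis
    by (simp add: Hausdorff_imp_t1_space)
qed

end
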